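(* Let $M\subset\mathbb{R}^N$ be a finite set with $|M|\ge 2$, equipped with the Euclidean metric $d$, and suppose $M$ is distance separated. Then the connected sparse graph $CS(M)$ is a tree.
   Context: $M$ is distance separated if all distances $d(x,y)$ between distinct unordered pairs $\{x,y\}\subset M$ are pairwise different. Construction of $CS(M)$ (all graphs simple, undirected, with vertex set $M$): $S_0$ has no edges, $K_0=\{\{x\}:x\in M\}$; $\nu_0(\{x\})=\min\{d(x,y):y\neq x\}$; $E(S_1)=\bigcup_{x}\{\{x,y\}:y\neq x,\ d(x,y)=\nu_0(\{x\})\}$. If $S_i$ has set of connected components $K_i$ with $|K_i|>1$, let $\nu_i(k)=\min\{d(x,y):x\in k, y\notin k\}$ for $k\in K_i$, $F(S_{i+1})=\bigcup_{k\in K_i}\{\{x,y\}:x\in k,\ y\notin k,\ d(x,y)=\nu_i(k)\}$ and $E(S_{i+1})=E(S_i)\cup F(S_{i+1})$. The construction stops at the first index $i$ such that $S_i$ is connected, and $CS(M):=S_i$. *)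

theory Defs
  imports "HOL-Analysis.Analysis"
begin

text \<open>An undirected graph is a pair of a vertex set and a set of two-element edges. The trees
  of the AFP entry Graph Theory are trees of digraphs, where a pair of opposite arcs already
  forms a cycle, so the undirected notions are defined here.\<close>

type_synonym 'a ugraph = "'a set \<times> 'a set set"

abbreviation verts :: "'a ugraph \<Rightarrow> 'a set" where "verts \<equiv> fst"
abbreviation edges :: "'a ugraph \<Rightarrow> 'a set set" where "edges \<equiv> snd"

definition simple_graph :: "'a ugraph \<Rightarrow> bool" where
  "simple_graph G \<longleftrightarrow> (\<forall>e \<in> edges G. e \<subseteq> verts G \<and> card e = 2)"

definition reach :: "'a ugraph \<Rightarrow> ('a \<times> 'a) set" where
  "reach G = {(x, y). x \<in> verts G \<and> y \<in> verts G \<and> (x, y) \<in> {(u, v). {u, v} \<in> edges G}\<^sup>*}"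

definition graph_components :: "'a ugraph \<Rightarrow> 'a set set" where
  "graph_components G = verts G // reach G"

definition graph_connected :: "'a ugraph \<Rightarrow> bool" where
  "graph_connected G \<longleftrightarrow>
     verts G \<noteq> {} \<and> (\<forall>x \<in> verts G. \<forall>y \<in> verts G. (x, y) \<in> reach G)"

text \<open>A cycle is given by the list of its pairwise distinct vertices in cyclic order, with the
  starting vertex not repeated at the end.\<close>

definition graph_cycle :: "'a ugraph \<Rightarrow> 'a list \<Rightarrow> bool" where
  "graph_cycle G c \<longleftrightarrow> length c \<ge> 3 \<and> distinct c \<and> set c \<subseteq> verts G \<and>
     (\<forall>i < length c. {c ! i, c ! (Suc i mod length c)} \<in> edges G)"

definition graph_tree :: "'a ugraph \<Rightarrow> bool" where
  "graph_tree G \<longleftrightarrow> simple_graph G \<and> graph_connected G \<and> \<not> (\<exists>c. graph_cycle G c)"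

definition distance_separated :: "'a::metric_space set \<Rightarrow> bool" where
  "distance_separated M \<longleftrightarrow>
     (\<forall>x\<in>M. \<forall>y\<in>M. \<forall>u\<in>M. \<forall>v\<in>M.
        x \<noteq> y \<and> u \<noteq> v \<and> {x, y} \<noteq> {u, v} \<longrightarrow> dist x y \<noteq> dist u v)"

definition nearest_dist :: "'a::metric_space set \<Rightarrow> 'a set \<Rightarrow> real" where
  "nearest_dist M k = Min {dist x y | x y. x \<in> k \<and> y \<in> M - k}"

definition nearest_edges :: "'a::metric_space set \<Rightarrow> 'a set set \<Rightarrow> 'a set set" where
  "nearest_edges M K =
     (\<Union>k\<in>K. {{x, y} | x y. x \<in> k \<and> y \<in> M - k \<and> dist x y = nearest_dist M k})"

text \<open>The graphs \<open>S\<^sub>i\<close>. To be total, the sequence is continued as constant once there is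
  only one component; \<open>CS\<close> does not depend on this continuation.\<close>

primrec sparse_graph :: "'a::metric_space set \<Rightarrow> nat \<Rightarrow> 'a ugraph" where
  "sparse_graph M 0 = (M, {})"
| "sparse_graph M (Suc i) =
     (let S = sparse_graph M i; K = graph_components S in
        if card K > 1 then (M, edges S \<union> nearest_edges M K) else S)"

text \<open>If no \<open>S\<^sub>i\<close> were connected, the index below would be an unspecified number; \<open>CS M\<close> would
  then be some disconnected \<open>S\<^sub>i\<close>. So connectedness of \<open>CS M\<close> includes termination of the
  construction.\<close>

definition CS :: "'a::metric_space set \<Rightarrow> 'a ugraph" where
  "CS M = sparse_graph M (LEAST i. graph_connected (sparse_graph M i))"

text \<open>The first step written out: the components of \<open>S\<^sub>0\<close> are the singletons, and \<open>S\<^sub>1\<close>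
  joins every point to its nearest neighbours.\<close>

lemma graph_components_sparse_graph_0: "graph_components (sparse_graph M 0) = {{x} | x. x \<in> M}"
  by (auto simp: graph_components_def reach_def quotient_def)

lemma edges_sparse_graph_1:
  assumes "card M \<ge> 2"
  shows "edges (sparse_graph M 1) =
    (\<Union>x\<in>M. {{x, y} | y. y \<in> M \<and> y \<noteq> x \<and> dist x y = Min {dist x z | z. z \<in> M \<and> z \<noteq> x}})"
proof -
  have eq: "graph_components (M, {}) = (\<lambda>x. {x}) ` M"
    using graph_components_sparse_graph_0[of M] by auto
  have c: "card ((\<lambda>x. {x}) ` M) = card M"
    by (simp add: card_image)
  have n: "nearest_dist M {x} = Min {dist x z | z. z \<in> M \<and> z \<noteq> x}" for x
    unfolding nearest_dist_def by (rule arg_cong[where f = Min]) auto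
  have "edges (sparse_graph M 1) = nearest_edges M ((\<lambda>x. {x}) ` M)"
    using assms by (simp add: Let_def eq c)
  also have "\<dots> = (\<Union>x\<in>M. {{x, y} | y. y \<in> M \<and> y \<noteq> x \<and>
      dist x y = Min {dist x z | z. z \<in> M \<and> z \<noteq> x}})"
    unfolding nearest_edges_def by (auto simp: n)
  finally show ?thesis .
qed

end

theory Submission
  imports Defs
begin

text \<open>Every edge of \<open>S\<^sub>i\<close> is a shortest pair across some cut of \<open>M\<close>. On a cycle, take a longest
  edge and a cut that it crosses as a shortest pair: the rest of the cycle crosses this cut back,
  by an edge which then has the same length, contradicting distance separation. The construction
  terminates since an unconnected stage gains an edge in the next step and \<open>M\<close> has only finitely
  many pairs.\<close>

text \<open>The cut depends on \<open>M\<close> and \<open>k\<close> alone, not on a graph, so it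
  remains a witness for an edge after the component \<open>k\<close> has been merged into a larger
  one.\<close>

definition shortest_across :: "'a::metric_space set \<Rightarrow> 'a set \<Rightarrow> 'a \<Rightarrow> 'a \<Rightarrow> bool" where
  "shortest_across M k x y \<longleftrightarrow> x \<in> k \<and> y \<in> M - k \<and> (\<forall>u\<in>k. \<forall>v\<in>M - k. dist x y \<le> dist u v)"

lemma finite_dists:
  assumes "finite A" "finite B"
  shows "finite {dist x y | x y. x \<in> A \<and> y \<in> B}"
proof -
  have "{dist x y | x y. x \<in> A \<and> y \<in> B} = (\<lambda>(x, y). dist x y) ` (A \<times> B)"
    by auto
  with assms show ?thesis by simp
qed

lemma shortest_across_if_nearest_dist:
  assumes "finite M" "k \<subseteq> M" "x \<in> k" "y \<in> M - k" "dist x y = nearest_dist M k"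
  shows "shortest_across M k x y"
proof -
  have "finite {dist x y | x y. x \<in> k \<and> y \<in> M - k}"
    using assms by (intro finite_dists) (auto intro: finite_subset)
  then have "nearest_dist M k \<le> dist u v" if "u \<in> k" "v \<in> M - k" for u v
    unfolding nearest_dist_def using that by (intro Min_le) auto
  with assms show ?thesis by (auto simp: shortest_across_def)
qed

text \<open>\<open>Min\<close> of the empty set is unspecified, so both sides of the cut must be
  inhabited.\<close>

lemma nearest_dist_attained:
  assumes "finite M" "k \<subseteq> M" "k \<noteq> {}" "M - k \<noteq> {}"
  obtains x y where "x \<in> k" "y \<in> M - k" "dist x y = nearest_dist M k"
proof -
  have "finite {dist x y | x y. x \<in> k \<and> y \<in> M - k}"
    using assms by (intro finite_dists) (auto intro: finite_subset)
  then have "nearest_dist M k \<in> {dist x y | x y. x \<in> k \<and> y \<in> M - k}"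
    unfolding nearest_dist_def using assms by (intro Min_in) auto
  then show ?thesis using that by auto
qed

lemma verts_sparse_graph [simp]: "verts (sparse_graph M i) = M"
  by (induction i) (auto simp: Let_def)

lemma graph_component_subset: "k \<in> graph_components G \<Longrightarrow> k \<subseteq> verts G"
  by (auto simp: graph_components_def quotient_def reach_def)

lemma graph_component_edge_closed:
  assumes "k \<in> graph_components G" "x \<in> k" "y \<in> verts G" "{x, y} \<in> edges G"
  shows "y \<in> k"
  using assms by (auto simp: graph_components_def quotient_def reach_def intro: rtrancl_into_rtrancl)

text \<open>An edge keeps the cut from the step that added it: the component from which it was
  chosen.\<close>

lemma sparse_graph_edge_shortest_across:
  assumes "finite M" "e \<in> edges (sparse_graph M i)"
  shows "\<exists>k x y. k \<subseteq> M \<and> e = {x, y} \<and> shortest_across M k x y"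
  using assms(2)
proof (induction i)
  case 0
  then show ?case by simp
next
  case (Suc i)
  let ?K = "graph_components (sparse_graph M i)"
  consider "e \<in> edges (sparse_graph M i)" | "e \<in> nearest_edges M ?K"
    using Suc.prems by (auto simp: Let_def split: if_splits)
  then show ?case
  proof cases
    case 1
    then show ?thesis by (rule Suc.IH)
  next
    case 2
    then obtain k x y where "k \<in> ?K" "e = {x, y}" "x \<in> k" "y \<in> M - k"
      "dist x y = nearest_dist M k"
      by (auto simp: nearest_edges_def)
    then show ?thesis
      using graph_component_subset[of k "sparse_graph M i"] assms(1)
        shortest_across_if_nearest_dist[of M k x y] by auto
  qed
qed

lemma simple_graph_sparse_graph:
  assumes "finite M"
  shows "simple_graph (sparse_graph M i)"
proof -
  \<comment> \<open>The ends lie on opposite sides of a cut, hence differ.\<close>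
  have "e \<subseteq> M \<and> card e = 2" if "e \<in> edges (sparse_graph M i)" for e
    using sparse_graph_edge_shortest_across[OF assms that]
    by (auto simp: shortest_across_def card_2_iff)
  then show ?thesis by (auto simp: simple_graph_def)
qed

text \<open>A discrete intermediate value principle, meant for the path that is left when one edge
  is removed from a cycle.\<close>

lemma ex_side_change:
  assumes "P (0::nat) \<noteq> P n"
  shows "\<exists>j<n. P j \<noteq> P (Suc j)"
  using assms
proof (induction n)
  case (Suc n)
  then show ?case by (cases "P 0 = P n") (auto intro: less_SucI)
qed simp

lemma sparse_graph_acyclic:
  assumes fin: "finite M" and sep: "distance_separated M"
  shows "\<not> graph_cycle (sparse_graph M i) c"
proof
  let ?S = "sparse_graph M i"
  assume cyc: "graph_cycle ?S c"
  define n where "n = length c"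
  have n: "n \<ge> 3" and dis: "distinct c" and sub: "set c \<subseteq> M"
    and edge: "\<And>j. j < n \<Longrightarrow> {c ! j, c ! (Suc j mod n)} \<in> edges ?S"
    using cyc by (auto simp: graph_cycle_def n_def)
  define len where "len j = dist (c ! j) (c ! (Suc j mod n))" for j
  have "Max (len ` {..<n}) \<in> len ` {..<n}"
    using n by (intro Max_in) (auto simp: lessThan_empty_iff)
  then obtain m where m: "m < n" and "len m = Max (len ` {..<n})"
    by auto
  then have len_le: "len j \<le> len m" if "j < n" for j
    using that by simp
  \<comment> \<open>The rotation makes the longest edge the closing one, from
    \<open>w ! (n - 1)\<close> back to \<open>w ! 0\<close>. The other edges are then the pairs
    \<open>w ! j\<close>, \<open>w ! Suc j\<close>, with no index modulo \<open>n\<close>.\<close>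
  define w where "w = rotate (Suc m) c"
  have w: "distinct w" "length w = n" "set w \<subseteq> M"
    using dis sub by (auto simp: w_def n_def)
  have w_nth: "w ! j = c ! ((Suc m + j) mod n)" if "j < n" for j
    using that nth_rotate[of j c "Suc m"] by (simp only: w_def n_def)
  have w_first: "w ! 0 = c ! (Suc m mod n)"
    using w_nth[of 0] n by simp
  have w_last: "w ! (n - 1) = c ! m"
  proof -
    have "Suc m + (n - 1) = m + n" using n by simp
    then show ?thesis using w_nth[of "n - 1"] n m by simp
  qed
  have w_step: "dist (w ! j) (w ! Suc j) \<le> dist (w ! 0) (w ! (n - 1))" if "Suc j < n" for j
  proof -
    have "Suc ((Suc m + j) mod n) mod n = (Suc m + Suc j) mod n"
      by (simp add: mod_Suc_eq)
    then have "dist (w ! j) (w ! Suc j) = len ((Suc m + j) mod n)"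
      using that by (simp add: w_nth len_def)
    also have "\<dots> \<le> len m" using n by (intro len_le) simp
    finally show ?thesis unfolding len_def w_first w_last by (simp add: dist_commute)
  qed
  obtain k x y where kxy: "{w ! 0, w ! (n - 1)} = {x, y}" "shortest_across M k x y"
    using sparse_graph_edge_shortest_across[OF fin edge[OF m]] w_first w_last
    by (metis insert_commute)
  \<comment> \<open>Either end may be the one inside \<open>k\<close>, so only the change of side is
    recorded.\<close>
  then have "(w ! 0 \<in> k) \<noteq> (w ! (n - 1) \<in> k)"
    by (auto simp: shortest_across_def doubleton_eq_iff)
  then obtain j where j: "j < n - 1" and side: "(w ! j \<in> k) \<noteq> (w ! Suc j \<in> k)"
    using ex_side_change[of "\<lambda>j. w ! j \<in> k" "n - 1"] by auto
  have in_M: "w ! l \<in> M" if "l < n" for l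
    using that w nth_mem by blast
  have ends: "dist (w ! 0) (w ! (n - 1)) = dist x y"
    using kxy(1) by (auto simp: doubleton_eq_iff dist_commute)
  have "dist x y \<le> dist (w ! j) (w ! Suc j)"
    using kxy(2) side in_M[of j] in_M[of "Suc j"] j
    by (auto simp: shortest_across_def dist_commute)
  \<comment> \<open>The closing edge is longest on the cycle and shortest across the cut, which
    bounds the crossing edge from both sides.\<close>
  with w_step[of j] ends j have eq: "dist (w ! j) (w ! Suc j) = dist (w ! 0) (w ! (n - 1))"
    by simp
  have nth_eq: "w ! a = w ! b \<longleftrightarrow> a = b" if "a < n" "b < n" for a b
    using that w nth_eq_iff_index_eq by blast
  have "{w ! j, w ! Suc j} = {w ! 0, w ! (n - 1)}"
  proof (rule ccontr)
    assume "{w ! j, w ! Suc j} \<noteq> {w ! 0, w ! (n - 1)}"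
    moreover have "w ! j \<noteq> w ! Suc j" "w ! 0 \<noteq> w ! (n - 1)"
      using nth_eq[of j "Suc j"] nth_eq[of 0 "n - 1"] n j by auto
    ultimately have "dist (w ! j) (w ! Suc j) \<noteq> dist (w ! 0) (w ! (n - 1))"
      using sep in_M[of j] in_M[of "Suc j"] in_M[of 0] in_M[of "n - 1"] n j
      unfolding distance_separated_def by simp
    with eq show False by contradiction
  qed
  \<comment> \<open>Vertices are distinct, so equal pairs have equal indices. The first case would
    give \<open>n = 2\<close>, against \<open>n \<ge> 3\<close>; the second is absurd.\<close>
  then have "j = 0 \<and> Suc j = n - 1 \<or> j = n - 1 \<and> Suc j = 0"
    using nth_eq[of j 0] nth_eq[of "Suc j" "n - 1"] nth_eq[of j "n - 1"] nth_eq[of "Suc j" 0] n j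
    by (auto simp: doubleton_eq_iff)
  with n j show False by auto
qed

text \<open>A component is closed under the present edges, so a nearest edge leaving it must be
  new.\<close>

lemma edges_sparse_graph_psubset:
  assumes fin: "finite M" and "M \<noteq> {}" and "\<not> graph_connected (sparse_graph M i)"
  shows "edges (sparse_graph M i) \<subset> edges (sparse_graph M (Suc i))"
proof -
  let ?S = "sparse_graph M i"
  let ?K = "graph_components ?S"
  obtain x y where xy: "x \<in> M" "y \<in> M" "(x, y) \<notin> reach ?S"
    using assms by (auto simp: graph_connected_def)
  define k where "k = reach ?S `` {x}"
  have k: "k \<in> ?K" "reach ?S `` {y} \<in> ?K"
    using xy by (auto simp: graph_components_def k_def intro: quotientI)
  have refl: "x \<in> k" "y \<in> reach ?S `` {y}" and y: "y \<notin> k"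
    using xy by (auto simp: k_def reach_def)
  \<comment> \<open>\<open>card\<close> is 0 on infinite sets, so finiteness is needed before two
    distinct components can force the growing branch of the recursion.\<close>
  have "finite ?K"
    using graph_component_subset[of _ ?S] fin by (intro finite_subset[of ?K "Pow M"]) auto
  with k refl y have "card ?K > 1"
    by (metis One_nat_def card_le_Suc0_iff_eq not_le)
  then have edges_Suc: "edges (sparse_graph M (Suc i)) = edges ?S \<union> nearest_edges M ?K"
    by (simp add: Let_def)
  have sub: "k \<subseteq> M"
    using graph_component_subset[OF k(1)] by simp
  obtain u v where uv: "u \<in> k" "v \<in> M - k" "dist u v = nearest_dist M k"
    using nearest_dist_attained[OF fin sub] refl y xy by blast
  then have "{u, v} \<in> nearest_edges M ?K"
    using k(1) unfolding nearest_edges_def by blast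
  moreover have "{u, v} \<notin> edges ?S"
    using graph_component_edge_closed[OF k(1) uv(1)] uv by auto
  ultimately show ?thesis using edges_Suc by auto
qed

lemma sparse_graph_eventually_connected:
  assumes fin: "finite M" and ne: "M \<noteq> {}"
  shows "\<exists>i. graph_connected (sparse_graph M i)"
proof (rule ccontr)
  assume "\<nexists>i. graph_connected (sparse_graph M i)"
  then have grow: "edges (sparse_graph M i) \<subset> edges (sparse_graph M (Suc i))" for i
    using edges_sparse_graph_psubset[OF fin ne] by blast
  have sub: "edges (sparse_graph M i) \<subseteq> Pow M" for i
    using simple_graph_sparse_graph[OF fin, of i] by (auto simp: simple_graph_def)
  then have fin_edges: "finite (edges (sparse_graph M i))" for i
    using fin by (meson finite_Pow_iff finite_subset)
  have "i \<le> card (edges (sparse_graph M i))" for i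
  proof (induction i)
    case (Suc i)
    with psubset_card_mono[OF fin_edges grow[of i]] show ?case by linarith
  qed simp
  moreover have "card (edges (sparse_graph M i)) \<le> card (Pow M)" for i
    using fin sub by (intro card_mono) auto
  \<comment> \<open>Both bounds are taken at stage \<open>Suc (card (Pow M))\<close>. The upper one
    is crude: edges are merely counted as subsets of \<open>M\<close>.\<close>
  ultimately have "Suc (card (Pow M)) \<le> card (Pow M)"
    by (meson order_trans)
  then show False by simp
qed

theorem theorem4p2:
  fixes M :: "(real ^ 'n) set"
  assumes "finite M" and "card M \<ge> 2"
    and "distance_separated M"
  shows "graph_tree (CS M)"
proof -
  have "M \<noteq> {}" using assms(2) by auto
  \<comment> \<open>Since some stage is connected, the \<open>LEAST\<close> index in
    \<open>CS\<close> really is a stopping index.\<close>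
  then have "graph_connected (CS M)"
    unfolding CS_def by (rule LeastI_ex[OF sparse_graph_eventually_connected[OF assms(1)]])
  then show ?thesis
    using simple_graph_sparse_graph[OF assms(1)] sparse_graph_acyclic[OF assms(1,3)]
    by (auto simp: graph_tree_def CS_def)
qed

end
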